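(* Let $V$ be a finite-dimensional complex vector space and let $\hat R\in \mathrm{Aut}(V^{\otimes 2})$ be a skew invertible R-matrix of BMW type, with parameters $q\in\mathbb C\setminus\{0,\pm1\}$ and $\nu\in\mathbb C\setminus\{0,q,-q^{-1}\}$. Put $\lambda:=q-q^{-1}$ and $$\hat K:=\lambda^{-1}\nu^{-1}(qI-\hat R)(q^{-1}I+\hat R)\in\mathrm{End}(V^{\otimes 2}).$$ Then the rank of the operator $\hat K$ equals $1$.
   Context: Notation. $V$ is a finite-dimensional vector space over $\mathbb C$. For $X\in\mathrm{End}(V^{\otimes 2})$ and $1\le k\ne l\le n$, $X_{kl}\in\mathrm{End}(V^{\otimes n})$ acts as $X$ on the tensor product of the $k$-th and $l$-th factors and as the identity on the other factors; $X_k:=X_{k\,k+1}$. $I$ is the identity operator, $P\in \mathrm{Aut}(V^{\otimes 2})$ is the permutation $P(u\otimes v)=v\otimes u$, and $\mathrm{Tr}_{(i)}$ is the partial trace over the $i$-th tensor factor. R-matrix. An element $\hat R\in\mathrm{Aut}(V^{\otimes 2})$ is an R-matrix if $\hat R_1\hat R_2\hat R_1=\hat R_2\hat R_1\hat R_2$ in $\mathrm{End}(V^{\otimes 3})$. Skew invertibility. $\hat R\in\mathrm{Aut}(V^{\otimes 2})$ is skew invertible if there exists $\hat\Psi\in\mathrm{End}(V^{\otimes 2})$ with $\mathrm{Tr}_{(2)}(\hat R_{12}\hat\Psi_{23})=\mathrm{Tr}_{(2)}(\hat\Psi_{12}\hat R_{23})=P_{13}$. Birman-Murakami-Wenzl algebra.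 For $q\in\mathbb C\setminus\{0,\pm1\}$, $\nu\in\mathbb C\setminus\{0,q,-q^{-1}\}$, $\lambda:=q-q^{-1}$, the algebra $W_n(q,\nu)$ is the quotient of the group algebra of the braid group on $n$ strands, given by generators $e_i$ (invertible) and $\kappa_i$, $i=1,\dots,n-1$, and relations $$e_ie_{i+1}e_i=e_{i+1}e_ie_{i+1},\qquad e_ie_j=e_je_i\ (|i-j|>1),\qquad e_i^2=1+\lambda(e_i-\nu\kappa_i),$$ $$e_i\kappa_i=\kappa_ie_i=\nu\kappa_i,\qquad \kappa_{i+1}e_i\kappa_{i+1}=\nu^{-1}\kappa_{i+1},\qquad \kappa_{i+1}e_i^{-1}\kappa_{i+1}=\nu\,\kappa_{i+1}.$$ In particular $\kappa_i=\lambda^{-1}\nu^{-1}(q-e_i)(q^{-1}+e_i)$. BMW type. An R-matrix $\hat R$ is of BMW type (with parameters $q,\nu$) if its minimal polynomial has degree $3$ and, for every $n$, the assignment $e_i\mapsto\hat R_i$ (hence $\kappa_i\mapsto\hat K_i$, where $\hat K=\lambda^{-1}\nu^{-1}(qI-\hat R)(q^{-1}I+\hat R)$) defines a representation of $W_n(q,\nu)$ on $V^{\otimes n}$. *)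

theory Defs
  imports Complex_Main "Jordan_Normal_Form.DL_Rank"
begin

text \<open>
  \<open>V = \<complex>\<^sup>d\<close> with its standard basis \<open>v\<^sub>0, \<dots>, v\<^sub>d\<^sub>-\<^sub>1\<close>, and \<open>V\<^sup>\<otimes>\<^sup>n\<close> is \<open>\<complex>\<close> to the power \<open>d ^ n\<close>: the basis tensor
  \<open>v\<^bsub>a 1\<^esub> \<otimes> \<dots> \<otimes> v\<^bsub>a n\<^esub>\<close> has the index with base-\<open>d\<close> digits \<open>a 1, \<dots>, a n\<close>, the first factor
  being the most significant digit. Endomorphisms are identified with their matrices.
  Tensor factors and the generators of the algebra are numbered from 1, as usual.
\<close>

definition tensor_digit :: "nat \<Rightarrow> nat \<Rightarrow> nat \<Rightarrow> nat \<Rightarrow> nat" where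
  "tensor_digit d n k i = (i div d ^ (n - k)) mod d"

definition on_factors :: "nat \<Rightarrow> nat \<Rightarrow> nat \<Rightarrow> nat \<Rightarrow> complex mat \<Rightarrow> complex mat" where
  "on_factors d n k l X = mat (d ^ n) (d ^ n) (\<lambda>(i, j).
     if \<forall>m \<in> {1..n} - {k, l}. tensor_digit d n m i = tensor_digit d n m j
     then X $$ (tensor_digit d n k i * d + tensor_digit d n l i,
                tensor_digit d n k j * d + tensor_digit d n l j)
     else 0)"

abbreviation on_adjacent :: "nat \<Rightarrow> nat \<Rightarrow> nat \<Rightarrow> complex mat \<Rightarrow> complex mat" where
  "on_adjacent d n k X \<equiv> on_factors d n k (k + 1) X"

definition flip_mat :: "nat \<Rightarrow> complex mat" where
  "flip_mat d = mat (d ^ 2) (d ^ 2) (\<lambda>(i, j).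
     if tensor_digit d 2 1 i = tensor_digit d 2 2 j \<and> tensor_digit d 2 2 i = tensor_digit d 2 1 j
     then 1 else 0)"

text \<open>
  \<open>insert_digit d n k a i\<close> is the index of the basis tensor of \<open>V\<^sup>\<otimes>\<^sup>n\<close> obtained from the one with
  index \<open>i\<close> in the \<open>(n - 1)\<close>-st tensor power by inserting \<open>v\<^sub>a\<close> as the new \<open>k\<close>-th factor.
\<close>

definition insert_digit :: "nat \<Rightarrow> nat \<Rightarrow> nat \<Rightarrow> nat \<Rightarrow> nat \<Rightarrow> nat" where
  "insert_digit d n k a i = ((i div d ^ (n - k)) * d + a) * d ^ (n - k) + i mod d ^ (n - k)"

definition partial_trace :: "nat \<Rightarrow> nat \<Rightarrow> nat \<Rightarrow> complex mat \<Rightarrow> complex mat" where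
  "partial_trace d n k A = mat (d ^ (n - 1)) (d ^ (n - 1)) (\<lambda>(i, j).
     \<Sum>a<d. A $$ (insert_digit d n k a i, insert_digit d n k a j))"

definition R_matrix :: "nat \<Rightarrow> complex mat \<Rightarrow> bool" where
  "R_matrix d R \<longleftrightarrow> R \<in> carrier_mat (d ^ 2) (d ^ 2) \<and> invertible_mat R \<and>
     on_adjacent d 3 1 R * on_adjacent d 3 2 R * on_adjacent d 3 1 R =
     on_adjacent d 3 2 R * on_adjacent d 3 1 R * on_adjacent d 3 2 R"

text \<open>
  The trace over the second factor of an endomorphism of \<open>V\<^sup>\<otimes>\<^sup>3\<close> is an endomorphism of the tensor
  product of the first and third factors; there the flip of these two is \<open>flip_mat d\<close>.
\<close>

definition skew_invertible :: "nat \<Rightarrow> complex mat \<Rightarrow> bool" where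
  "skew_invertible d R \<longleftrightarrow> (\<exists>\<Psi> \<in> carrier_mat (d ^ 2) (d ^ 2).
     partial_trace d 3 2 (on_factors d 3 1 2 R * on_factors d 3 2 3 \<Psi>) = flip_mat d \<and>
     partial_trace d 3 2 (on_factors d 3 1 2 \<Psi> * on_factors d 3 2 3 R) = flip_mat d)"

definition poly_at_mat :: "complex poly \<Rightarrow> complex mat \<Rightarrow> complex mat" where
  "poly_at_mat p A = mat (dim_row A) (dim_row A) (\<lambda>(i, j).
     \<Sum>k\<le>degree p. coeff p k * (A ^\<^sub>m k) $$ (i, j))"

definition annihilates :: "complex poly \<Rightarrow> complex mat \<Rightarrow> bool" where
  "annihilates p A \<longleftrightarrow> poly_at_mat p A = 0\<^sub>m (dim_row A) (dim_row A)"

definition is_minimal_poly :: "complex poly \<Rightarrow> complex mat \<Rightarrow> bool" where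
  "is_minimal_poly p A \<longleftrightarrow> lead_coeff p = 1 \<and> annihilates p A \<and> (\<forall>r. annihilates r A \<longrightarrow> p dvd r)"

text \<open>
  A representation of \<open>W\<^sub>n(q,\<nu>)\<close> on \<open>\<complex>\<^sup>N\<close>, given by the images \<open>e i\<close>, \<open>e' i\<close>, \<open>\<kappa> i\<close> of the generators
  \<open>e\<^sub>i\<close>, their inverses and \<open>\<kappa>\<^sub>i\<close> (\<open>1 \<le> i \<le> n - 1\<close>): these have to satisfy the defining relations.
\<close>

definition BMW_representation ::
  "complex \<Rightarrow> complex \<Rightarrow> nat \<Rightarrow> nat \<Rightarrow> (nat \<Rightarrow> complex mat) \<Rightarrow> (nat \<Rightarrow> complex mat) \<Rightarrow>
     (nat \<Rightarrow> complex mat) \<Rightarrow> bool" where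
  "BMW_representation q \<nu> n N e e' \<kappa> \<longleftrightarrow>
     (\<forall>i \<in> {1..<n}. e i \<in> carrier_mat N N \<and> e' i \<in> carrier_mat N N \<and> \<kappa> i \<in> carrier_mat N N) \<and>
     (\<forall>i \<in> {1..<n}. e i * e' i = 1\<^sub>m N \<and> e' i * e i = 1\<^sub>m N) \<and>
     (\<forall>i. i \<in> {1..<n} \<and> i + 1 \<in> {1..<n} \<longrightarrow>
        e i * e (i + 1) * e i = e (i + 1) * e i * e (i + 1)) \<and>
     (\<forall>i \<in> {1..<n}. \<forall>j \<in> {1..<n}. \<bar>int i - int j\<bar> > 1 \<longrightarrow> e i * e j = e j * e i) \<and>
     (\<forall>i \<in> {1..<n}. e i * e i = 1\<^sub>m N + (q - inverse q) \<cdot>\<^sub>m (e i - \<nu> \<cdot>\<^sub>m \<kappa> i)) \<and>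
     (\<forall>i \<in> {1..<n}. e i * \<kappa> i = \<nu> \<cdot>\<^sub>m \<kappa> i \<and> \<kappa> i * e i = \<nu> \<cdot>\<^sub>m \<kappa> i) \<and>
     (\<forall>i. i \<in> {1..<n} \<and> i + 1 \<in> {1..<n} \<longrightarrow>
        \<kappa> (i + 1) * e i * \<kappa> (i + 1) = inverse \<nu> \<cdot>\<^sub>m \<kappa> (i + 1) \<and>
        \<kappa> (i + 1) * e' i * \<kappa> (i + 1) = \<nu> \<cdot>\<^sub>m \<kappa> (i + 1))"

definition K_mat :: "nat \<Rightarrow> complex \<Rightarrow> complex \<Rightarrow> complex mat \<Rightarrow> complex mat" where
  "K_mat d q \<nu> R = (inverse (q - inverse q) * inverse \<nu>) \<cdot>\<^sub>m
     ((q \<cdot>\<^sub>m 1\<^sub>m (d ^ 2) - R) * (inverse q \<cdot>\<^sub>m 1\<^sub>m (d ^ 2) + R))"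

definition BMW_type :: "nat \<Rightarrow> complex \<Rightarrow> complex \<Rightarrow> complex mat \<Rightarrow> bool" where
  "BMW_type d q \<nu> R \<longleftrightarrow> R_matrix d R \<and>
     (\<exists>p. is_minimal_poly p R \<and> degree p = 3) \<and>
     (\<forall>n. \<exists>e'. BMW_representation q \<nu> n (d ^ n)
        (\<lambda>i. on_adjacent d n i R) e' (\<lambda>i. on_adjacent d n i (K_mat d q \<nu> R)))"

end

theory Submission
  imports Defs
begin

text \<open>
  Let \<open>B\<^sub>i\<close> and \<open>A\<^sub>j\<close> be the \<open>i\<close>-th row and the \<open>j\<close>-th column of \<open>K\<close>, reshaped to endomorphisms of \<open>V\<close>.
  In components, \<open>K\<^sub>2 X\<^sub>1 K\<^sub>2\<close> consists of the operators \<open>Tr\<^sub>(\<^sub>2\<^sub>) (X (I \<otimes> A\<^sub>j B\<^sub>i\<^sup>T))\<close>. For \<open>X = R\<close> these are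
  \<open>\<nu>\<^sup>-\<^sup>1 K\<^sub>i\<^sub>j I\<close>, and skew invertibility, which inverts \<open>T \<mapsto> Tr\<^sub>(\<^sub>2\<^sub>) (R (I \<otimes> T))\<close>, turns this into
  \<open>A\<^sub>j B\<^sub>i\<^sup>T = \<nu>\<^sup>-\<^sup>1 K\<^sub>i\<^sub>j D\<close> with \<open>D = Tr\<^sub>(\<^sub>2\<^sub>) \<Psi>\<close>. The relations \<open>K\<^sub>2 K\<^sub>1 K\<^sub>2 = K\<^sub>2\<close> and \<open>K\<^sub>1 K\<^sub>2 K\<^sub>1 = K\<^sub>1\<close> then give
  \<open>A\<^sub>j\<^sup>T B\<^sub>i D = \<nu> K\<^sub>i\<^sub>j I\<close>. For a nonzero entry \<open>K\<^sub>i\<^sub>j\<close> the matrices \<open>A\<^sub>j\<close> and \<open>D\<close> are therefore invertible,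
  so that every row of \<open>K\<close> is a multiple of the row \<open>i\<close>.
\<close>

subsection \<open>Matrix algebra\<close>

lemma index_mult_mat_sum:
  assumes "A \<in> carrier_mat nr n" "B \<in> carrier_mat n nc" "i < nr" "j < nc"
  shows "(A * B) $$ (i, j) = (\<Sum>k<n. A $$ (i, k) * B $$ (k, j))"
  using assms by (auto simp: scalar_prod_def atLeast0LessThan)

lemma smult_smult_mat:
  fixes A :: "'a::semigroup_mult mat"
  shows "a \<cdot>\<^sub>m (b \<cdot>\<^sub>m A) = (a * b) \<cdot>\<^sub>m A"
  by (intro eq_matI) (auto simp: mult.assoc)

lemma one_smult_mat: "(1::'a::monoid_mult) \<cdot>\<^sub>m A = A"
  by (intro eq_matI) auto

lemma smult_mat_cancel_left:
  fixes A B :: "'a::field mat"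
  assumes "a \<noteq> 0"
  shows "a \<cdot>\<^sub>m A = a \<cdot>\<^sub>m B \<longleftrightarrow> A = B"
proof
  assume "a \<cdot>\<^sub>m A = a \<cdot>\<^sub>m B"
  then have "inverse a \<cdot>\<^sub>m (a \<cdot>\<^sub>m A) = inverse a \<cdot>\<^sub>m (a \<cdot>\<^sub>m B)" by simp
  then show "A = B"
    using assms by (simp add: smult_smult_mat one_smult_mat)
qed simp

lemma transpose_smult_mat: "transpose_mat (a \<cdot>\<^sub>m A) = a \<cdot>\<^sub>m transpose_mat A"
  by (intro eq_matI) auto

(* Simp cannot guess the dimensions of compound factors, hence these versions fix all of them. *)
lemmas square_mat_simps =
  assoc_mult_mat[where n\<^sub>1 = N and n\<^sub>2 = N and n\<^sub>3 = N and n\<^sub>4 = N]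
  add_mult_distrib_mat[where nr = N and n = N and nc = N]
  mult_add_distrib_mat[where nr = N and n = N and nc = N]
  minus_mult_distrib_mat[where nr = N and n = N and nc = N]
  mult_minus_distrib_mat[where nr = N and n = N and nc = N]
  mult_smult_distrib[where nr = N and n = N and nc = N]
  mult_smult_assoc_mat[where nr = N and n = N and nc = N]
  minus_carrier_mat[where nr = N and nc = N]
  for N

lemma mult_eq_smult_one_commute:
  fixes A B :: "'a::field mat"
  assumes A: "A \<in> carrier_mat n n" and B: "B \<in> carrier_mat n n"
    and "A * B = a \<cdot>\<^sub>m 1\<^sub>m n" "a \<noteq> 0"
  shows "B * A = a \<cdot>\<^sub>m 1\<^sub>m n"
proof -
  have "A * (inverse a \<cdot>\<^sub>m B) = 1\<^sub>m n"
    using assms by (simp add: mult_smult_distrib[OF A B] smult_smult_mat one_smult_mat)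
  then have "inverse a \<cdot>\<^sub>m (B * A) = 1\<^sub>m n"
    using mat_mult_left_right_inverse[OF A smult_carrier_mat[OF B]]
    by (simp add: mult_smult_assoc_mat[OF B A])
  then have "a \<cdot>\<^sub>m 1\<^sub>m n = a \<cdot>\<^sub>m (inverse a \<cdot>\<^sub>m (B * A))" by simp
  also have "\<dots> = B * A"
    using \<open>a \<noteq> 0\<close> by (simp add: smult_smult_mat one_smult_mat)
  finally show ?thesis ..
qed

lemma middle_factors_proportional:
  fixes X Y Y' Z :: "'a::field mat"
  assumes carrier: "X \<in> carrier_mat n n" "Y \<in> carrier_mat n n" "Y' \<in> carrier_mat n n"
      "Z \<in> carrier_mat n n"
    and XYZ: "X * Y * Z = a \<cdot>\<^sub>m 1\<^sub>m n" and XY'Z: "X * Y' * Z = b \<cdot>\<^sub>m 1\<^sub>m n" and "a \<noteq> 0"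
  shows "a \<cdot>\<^sub>m Y' = b \<cdot>\<^sub>m Y"
proof -
  have YZX: "(Y * Z) * X = a \<cdot>\<^sub>m 1\<^sub>m n"
    using carrier XYZ \<open>a \<noteq> 0\<close>
    by (intro mult_eq_smult_one_commute[of X n "Y * Z"]) (auto simp: square_mat_simps[where N = n])
  have ZXY: "Z * (X * Y) = a \<cdot>\<^sub>m 1\<^sub>m n"
    using carrier XYZ \<open>a \<noteq> 0\<close> by (intro mult_eq_smult_one_commute[of "X * Y" n Z]) auto
  have "a \<cdot>\<^sub>m (a \<cdot>\<^sub>m Y') = ((Y * Z) * X) * Y' * (Z * (X * Y))"
    unfolding YZX ZXY using carrier by (simp add: square_mat_simps[where N = n])
  also have "\<dots> = (Y * Z) * (X * Y' * Z) * (X * Y)"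
    using carrier by (simp add: square_mat_simps[where N = n])
  also have "\<dots> = b \<cdot>\<^sub>m (((Y * Z) * X) * Y)"
    unfolding XY'Z using carrier by (simp add: square_mat_simps[where N = n])
  also have "\<dots> = a \<cdot>\<^sub>m (b \<cdot>\<^sub>m Y)"
    unfolding YZX using carrier
    by (simp add: square_mat_simps[where N = n] smult_smult_mat mult.commute)
  finally show ?thesis
    using \<open>a \<noteq> 0\<close> by (simp add: smult_mat_cancel_left)
qed

lemma (in vec_space) rank_eq_1_product_entries:
  assumes A: "A \<in> carrier_mat n nc"
    and entries: "\<And>r c. r < n \<Longrightarrow> c < nc \<Longrightarrow> A $$ (r, c) = f r * g c"
    and nonzero: "A \<noteq> 0\<^sub>m n nc"
  shows "rank A = 1"
proof (rule antisym)
  show "rank A \<le> 1"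
    using A entries by (intro rank_le_1_product_entries[of A nc f g]) auto
  obtain i j where "i < n" "j < nc" "A $$ (i, j) \<noteq> 0"
    using nonzero A by (auto simp: mat_eq_iff)
  then have col: "col A j \<in> carrier_vec n" "col A j \<noteq> 0\<^sub>v n" "col A j \<in> set (cols A)"
    using A by (auto simp: cols_def vec_eq_iff)
  have "lin_indpt {}"
    using subset_li_is_li finite_basis_exists[OF fin_dim] unfolding basis_def by blast
  then have "lin_indpt {col A j}"
    using lin_dep_iff_in_span[of "{}" "col A j"] col by (simp add: span_empty)
  then show "1 \<le> rank A"
    using rank_ge_card_indpt[OF A, of "{col A j}"] col by simp
qed

subsection \<open>Partial traces and reshaped rows and columns\<close>

lemma digits_less:
  assumes "a < m" "b < (d::nat)"
  shows "a * d + b < m * d"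
proof -
  have "a * d + b < (a + 1) * d" using assms by (simp add: algebra_simps)
  also have "\<dots> \<le> m * d" using assms by (intro mult_right_mono) auto
  finally show ?thesis .
qed

lemma digits2_less: "a < d \<Longrightarrow> b < d \<Longrightarrow> a * d + b < (d::nat) ^ 2"
  unfolding power2_eq_square by (rule digits_less)

lemma sum_mult_digits:
  fixes f :: "nat \<Rightarrow> 'a::comm_monoid_add"
  shows "(\<Sum>x<m * d. f x) = (\<Sum>a<m. \<Sum>b<d. f (a * d + b))"
proof -
  have "(\<Sum>x = a * d..<a * d + d. f x) = (\<Sum>b<d. f (a * d + b))" for a
    using sum.shift_bounds_nat_ivl[of f 0 "a * d" d] by (simp add: atLeast0LessThan add.commute)
  then show ?thesis
    by (simp add: sum.nat_group[symmetric])
qed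

lemma sum_digits2:
  fixes f :: "nat \<Rightarrow> 'a::comm_monoid_add"
  shows "(\<Sum>x<d ^ 2. f x) = (\<Sum>a<d. \<Sum>b<d. f (a * d + b))"
  by (simp add: power2_eq_square sum_mult_digits)

lemma sum_swap_pairs:
  fixes f :: "'a \<Rightarrow> 'b \<Rightarrow> 'c \<Rightarrow> 'd \<Rightarrow> 'e::comm_monoid_add"
  shows "(\<Sum>a\<in>A. \<Sum>b\<in>B. \<Sum>c\<in>C. \<Sum>d\<in>D. f a b c d) = (\<Sum>c\<in>C. \<Sum>d\<in>D. \<Sum>a\<in>A. \<Sum>b\<in>B. f a b c d)"
proof -
  have "(\<Sum>a\<in>A. \<Sum>b\<in>B. \<Sum>c\<in>C. \<Sum>d\<in>D. f a b c d) = (\<Sum>(a, b)\<in>A \<times> B. \<Sum>(c, d)\<in>C \<times> D. f a b c d)"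
    by (simp flip: sum.cartesian_product)
  also have "\<dots> = (\<Sum>(c, d)\<in>C \<times> D. \<Sum>(a, b)\<in>A \<times> B. f a b c d)"
    unfolding case_prod_unfold by (rule sum.swap)
  also have "\<dots> = (\<Sum>c\<in>C. \<Sum>d\<in>D. \<Sum>a\<in>A. \<Sum>b\<in>B. f a b c d)"
    by (simp flip: sum.cartesian_product)
  finally show ?thesis .
qed

(* The partial traces of X (T \<otimes> I) over the first factor and of X (I \<otimes> T) over the second one. *)
definition trace_fst :: "nat \<Rightarrow> 'a::semiring_0 mat \<Rightarrow> 'a mat \<Rightarrow> 'a mat" where
  "trace_fst d X T = mat d d (\<lambda>(a, b). \<Sum>g<d. \<Sum>h<d. X $$ (g * d + a, h * d + b) * T $$ (h, g))"

definition trace_snd :: "nat \<Rightarrow> 'a::semiring_0 mat \<Rightarrow> 'a mat \<Rightarrow> 'a mat" where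
  "trace_snd d X T = mat d d (\<lambda>(a, b). \<Sum>g<d. \<Sum>h<d. X $$ (a * d + g, b * d + h) * T $$ (h, g))"

definition reshape_row :: "nat \<Rightarrow> 'a mat \<Rightarrow> nat \<Rightarrow> 'a mat" where
  "reshape_row d K i = mat d d (\<lambda>(a, b). K $$ (i, a * d + b))"

definition reshape_col :: "nat \<Rightarrow> 'a mat \<Rightarrow> nat \<Rightarrow> 'a mat" where
  "reshape_col d K j = mat d d (\<lambda>(a, b). K $$ (a * d + b, j))"

lemma trace_fst_carrier [simp]: "trace_fst d X T \<in> carrier_mat d d"
  by (simp add: trace_fst_def)

lemma trace_snd_carrier [simp]: "trace_snd d X T \<in> carrier_mat d d"
  by (simp add: trace_snd_def)

lemma reshape_row_carrier [simp]: "reshape_row d K i \<in> carrier_mat d d"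
  by (simp add: reshape_row_def)

lemma reshape_col_carrier [simp]: "reshape_col d K j \<in> carrier_mat d d"
  by (simp add: reshape_col_def)

lemma trace_snd_smult:
  fixes X T :: "'a::comm_semiring_0 mat"
  assumes "T \<in> carrier_mat d d"
  shows "trace_snd d X (c \<cdot>\<^sub>m T) = c \<cdot>\<^sub>m trace_snd d X T"
  using assms
  by (intro eq_matI) (auto simp: trace_snd_def sum_distrib_left mult_ac intro!: sum.cong)

lemma reshape_col_mult_row_index:
  fixes X Z :: "'a::comm_semiring_0 mat"
  assumes "a < d" "b < d"
  shows "(reshape_col d Z j * transpose_mat (reshape_row d X i)) $$ (a, b) =
    (\<Sum>h<d. X $$ (i, b * d + h) * Z $$ (a * d + h, j))"
  using assms
  by (subst index_mult_mat_sum[of _ d d]) (auto simp: reshape_col_def reshape_row_def mult.commute)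

lemma reshape_col_transpose_mult_row_index:
  fixes X Z :: "'a::comm_semiring_0 mat"
  assumes "a < d" "b < d"
  shows "(transpose_mat (reshape_col d Z j) * reshape_row d X i) $$ (a, b) =
    (\<Sum>g<d. X $$ (i, g * d + b) * Z $$ (g * d + a, j))"
  using assms
  by (subst index_mult_mat_sum[of _ d d]) (auto simp: reshape_col_def reshape_row_def mult.commute)

lemma mult_trace_snd_transpose_index:
  fixes M K T :: "'a::comm_semiring_0 mat"
  assumes "M \<in> carrier_mat d d" "x < d" "a < d"
  shows "(M * transpose_mat (trace_snd d K T)) $$ (x, a) =
    (\<Sum>g<d. \<Sum>h<d. (M * reshape_row d K (a * d + g)) $$ (x, h) * T $$ (h, g))"
proof -
  have "(M * transpose_mat (trace_snd d K T)) $$ (x, a) =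
      (\<Sum>y<d. \<Sum>g<d. \<Sum>h<d. M $$ (x, y) * K $$ (a * d + g, y * d + h) * T $$ (h, g))"
    using assms
    by (subst index_mult_mat_sum[of _ d d]) (auto simp: trace_snd_def sum_distrib_left mult.assoc)
  also have "\<dots> = (\<Sum>g<d. \<Sum>h<d. \<Sum>y<d. M $$ (x, y) * K $$ (a * d + g, y * d + h) * T $$ (h, g))"
    by (subst sum.swap, subst sum.swap) (rule refl)
  also have "\<dots> = (\<Sum>g<d. \<Sum>h<d. (M * reshape_row d K (a * d + g)) $$ (x, h) * T $$ (h, g))"
    using assms
    by (intro sum.cong refl, subst index_mult_mat_sum[of _ d d])
      (auto simp: reshape_row_def sum_distrib_right)
  finally show ?thesis .
qed

lemma eq_smult_one_if_rows_eigenvalue: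
  fixes M K T :: "'a::field mat"
  assumes M: "M \<in> carrier_mat d d"
    and trace: "trace_snd d K T = c \<cdot>\<^sub>m 1\<^sub>m d" "c \<noteq> 0"
    and rows: "\<And>i. i < d ^ 2 \<Longrightarrow> M * reshape_row d K i = m \<cdot>\<^sub>m reshape_row d K i"
  shows "M = m \<cdot>\<^sub>m 1\<^sub>m d"
proof -
  let ?U = "transpose_mat (trace_snd d K T)" and ?m = "m \<cdot>\<^sub>m 1\<^sub>m d"
  have "?m * reshape_row d K i = m \<cdot>\<^sub>m reshape_row d K i" for i
    by (simp add: mult_smult_assoc_mat[of _ d d _ d] left_mult_one_mat[of _ d d])
  then have "(M * ?U) $$ (x, a) = (?m * ?U) $$ (x, a)" if "x < d" "a < d" for x a
    using that M
    by (simp add: mult_trace_snd_transpose_index digits2_less rows del: index_mult_mat(1))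
  then have "M * ?U = ?m * ?U"
    using M carrier_matD[OF trace_snd_carrier[of d K T]]
    by (intro eq_matI) (auto simp del: index_mult_mat(1))
  then have "c \<cdot>\<^sub>m M = c \<cdot>\<^sub>m (m \<cdot>\<^sub>m 1\<^sub>m d)"
    using M by (simp add: trace(1) mult_smult_distrib[of _ d d _ d] transpose_smult_mat)
  then show ?thesis
    using trace(2) by (simp add: smult_mat_cancel_left)
qed

subsection \<open>The contraction identity forces rank one\<close>

lemma row_mult_trace_fst:
  fixes K D T :: "'a::comm_semiring_0 mat"
  assumes D: "D \<in> carrier_mat d d" and T: "T \<in> carrier_mat d d"
    and contraction: "\<And>j. j < d ^ 2 \<Longrightarrow>
      reshape_col d K j * transpose_mat (reshape_row d K i) = (s * K $$ (i, j)) \<cdot>\<^sub>m D"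
  shows "reshape_row d K i * trace_fst d K T = s \<cdot>\<^sub>m (transpose_mat (T * D) * reshape_row d K i)"
proof (rule eq_matI)
  fix x c
  assume "x < dim_row (s \<cdot>\<^sub>m (transpose_mat (T * D) * reshape_row d K i))"
    and "c < dim_col (s \<cdot>\<^sub>m (transpose_mat (T * D) * reshape_row d K i))"
  then have bounds: "x < d" "c < d" using D by (auto simp: reshape_row_def)
  have "(reshape_row d K i * trace_fst d K T) $$ (x, c) =
      (\<Sum>b<d. \<Sum>g<d. \<Sum>h<d. T $$ (h, g) * (K $$ (i, x * d + b) * K $$ (g * d + b, h * d + c)))"
    using bounds by (subst index_mult_mat_sum[of _ d d])
      (auto simp: reshape_row_def trace_fst_def sum_distrib_left mult_ac)
  also have "\<dots> = (\<Sum>g<d. \<Sum>h<d. T $$ (h, g) *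
      (\<Sum>b<d. K $$ (i, x * d + b) * K $$ (g * d + b, h * d + c)))"
    unfolding sum_distrib_left by (subst sum.swap, subst sum.swap) (rule refl)
  also have "\<dots> = (\<Sum>g<d. \<Sum>h<d. T $$ (h, g) * (s * K $$ (i, h * d + c) * D $$ (g, x)))"
    using bounds D
    by (intro sum.cong refl)
      (simp add: reshape_col_mult_row_index[symmetric] contraction digits2_less)
  also have "\<dots> = s * (\<Sum>h<d. (\<Sum>g<d. T $$ (h, g) * D $$ (g, x)) * K $$ (i, h * d + c))"
    by (subst sum.swap) (simp add: sum_distrib_left sum_distrib_right mult_ac)
  also have "\<dots> = s * (\<Sum>h<d. (T * D) $$ (h, x) * K $$ (i, h * d + c))"
    using bounds by (simp add: index_mult_mat_sum[OF T D] del: index_mult_mat(1))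
  also have "\<dots> = (s \<cdot>\<^sub>m (transpose_mat (T * D) * reshape_row d K i)) $$ (x, c)"
    using bounds T D
    by (simp add: index_mult_mat_sum[of "transpose_mat (T * D)" d d _ d] reshape_row_def
        del: index_mult_mat(1))
  finally show "(reshape_row d K i * trace_fst d K T) $$ (x, c) =
      (s \<cdot>\<^sub>m (transpose_mat (T * D) * reshape_row d K i)) $$ (x, c)" .
qed (use D in \<open>auto simp: reshape_row_def trace_fst_def\<close>)

lemma trace_snd_contraction:
  fixes K D :: "'a::field mat"
  assumes D: "D \<in> carrier_mat d d"
    and contraction:
      "reshape_col d K j * transpose_mat (reshape_row d K i) = (s * K $$ (i, j)) \<cdot>\<^sub>m D"
    and trace: "trace_snd d K (reshape_col d K j * transpose_mat (reshape_row d K i)) =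
      K $$ (i, j) \<cdot>\<^sub>m 1\<^sub>m d"
    and nonzero: "s \<noteq> 0" "K $$ (i, j) \<noteq> 0"
  shows "trace_snd d K D = inverse s \<cdot>\<^sub>m 1\<^sub>m d"
proof -
  have "(s * K $$ (i, j)) \<cdot>\<^sub>m trace_snd d K D = K $$ (i, j) \<cdot>\<^sub>m 1\<^sub>m d"
    using trace unfolding contraction trace_snd_smult[OF D] .
  also have "\<dots> = (s * K $$ (i, j)) \<cdot>\<^sub>m (inverse s \<cdot>\<^sub>m 1\<^sub>m d)"
    using nonzero by (simp add: smult_smult_mat field_simps)
  finally show ?thesis
    using nonzero by (simp add: smult_mat_cancel_left)
qed

lemma col_transpose_mult_row_mult_contraction:
  fixes K D :: "'a::field mat"
  assumes D: "D \<in> carrier_mat d d"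
    and contraction: "\<And>i j. i < d ^ 2 \<Longrightarrow> j < d ^ 2 \<Longrightarrow>
      reshape_col d K j * transpose_mat (reshape_row d K i) = (s * K $$ (i, j)) \<cdot>\<^sub>m D"
    and trace_fst: "trace_fst d K (transpose_mat (reshape_col d K j) * reshape_row d K i) =
      K $$ (i, j) \<cdot>\<^sub>m 1\<^sub>m d"
    and trace_snd: "trace_snd d K D = inverse s \<cdot>\<^sub>m 1\<^sub>m d" and "s \<noteq> 0"
  shows "transpose_mat (reshape_col d K j) * reshape_row d K i * D =
    (inverse s * K $$ (i, j)) \<cdot>\<^sub>m 1\<^sub>m d"
proof -
  define T where "T = transpose_mat (reshape_col d K j) * reshape_row d K i"
  have T: "T \<in> carrier_mat d d"
    by (simp add: T_def mult_carrier_mat[of _ d d])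
  then have TD: "T * D \<in> carrier_mat d d"
    using D by simp
  have "transpose_mat (T * D) * reshape_row d K l = (inverse s * K $$ (i, j)) \<cdot>\<^sub>m reshape_row d K l"
    if "l < d ^ 2" for l
  proof -
    have "s \<cdot>\<^sub>m (transpose_mat (T * D) * reshape_row d K l) = reshape_row d K l * trace_fst d K T"
      using row_mult_trace_fst[OF D T contraction[OF that]] by simp
    also have "\<dots> = K $$ (i, j) \<cdot>\<^sub>m reshape_row d K l"
      unfolding T_def trace_fst
      by (simp add: mult_smult_distrib[of _ d d _ d] right_mult_one_mat[of _ d d])
    also have "\<dots> = s \<cdot>\<^sub>m ((inverse s * K $$ (i, j)) \<cdot>\<^sub>m reshape_row d K l)"
      using \<open>s \<noteq> 0\<close> by (simp add: smult_smult_mat flip: mult.assoc)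
    finally show ?thesis
      using \<open>s \<noteq> 0\<close> by (simp add: smult_mat_cancel_left)
  qed
  then have "transpose_mat (T * D) = (inverse s * K $$ (i, j)) \<cdot>\<^sub>m 1\<^sub>m d"
    using TD \<open>s \<noteq> 0\<close> by (intro eq_smult_one_if_rows_eigenvalue[OF _ trace_snd]) auto
  then have "transpose_mat (transpose_mat (T * D)) =
      transpose_mat ((inverse s * K $$ (i, j)) \<cdot>\<^sub>m 1\<^sub>m d)"
    by simp
  then show ?thesis
    unfolding T_def by (simp add: transpose_smult_mat)
qed

lemma rank_eq_1_contraction:
  fixes K D :: "'a::field mat"
  assumes K: "K \<in> carrier_mat (d ^ 2) (d ^ 2)" "K \<noteq> 0\<^sub>m (d ^ 2) (d ^ 2)"
    and D: "D \<in> carrier_mat d d" and "s \<noteq> 0"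
    and contraction: "\<And>i j. i < d ^ 2 \<Longrightarrow> j < d ^ 2 \<Longrightarrow>
      reshape_col d K j * transpose_mat (reshape_row d K i) = (s * K $$ (i, j)) \<cdot>\<^sub>m D"
    and trace_snd: "\<And>i j. i < d ^ 2 \<Longrightarrow> j < d ^ 2 \<Longrightarrow>
      trace_snd d K (reshape_col d K j * transpose_mat (reshape_row d K i)) = K $$ (i, j) \<cdot>\<^sub>m 1\<^sub>m d"
    and trace_fst: "\<And>i j. i < d ^ 2 \<Longrightarrow> j < d ^ 2 \<Longrightarrow>
      trace_fst d K (transpose_mat (reshape_col d K j) * reshape_row d K i) = K $$ (i, j) \<cdot>\<^sub>m 1\<^sub>m d"
  shows "vec_space.rank (d ^ 2) K = 1"
proof -
  obtain i0 j0 where i0: "i0 < d ^ 2" and j0: "j0 < d ^ 2" and nonzero: "K $$ (i0, j0) \<noteq> 0"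
    using K by (auto simp: mat_eq_iff)
  have "trace_snd d K D = inverse s \<cdot>\<^sub>m 1\<^sub>m d"
    by (rule trace_snd_contraction[OF D contraction trace_snd]) (fact i0 j0 nonzero \<open>s \<noteq> 0\<close>)+
  then have col_row_D: "transpose_mat (reshape_col d K j0) * reshape_row d K i * D =
      (inverse s * K $$ (i, j0)) \<cdot>\<^sub>m 1\<^sub>m d" if "i < d ^ 2" for i
    using col_transpose_mult_row_mult_contraction[OF D contraction trace_fst[OF that j0]] \<open>s \<noteq> 0\<close>
    by simp
  have rows: "(inverse s * K $$ (i0, j0)) \<cdot>\<^sub>m reshape_row d K i =
      (inverse s * K $$ (i, j0)) \<cdot>\<^sub>m reshape_row d K i0"
    if "i < d ^ 2" for i
    using that i0 nonzero \<open>s \<noteq> 0\<close> D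
    by (intro middle_factors_proportional[OF _ _ _ _ col_row_D col_row_D]) auto
  have "K $$ (i, j) = K $$ (i, j0) * (K $$ (i0, j) / K $$ (i0, j0))"
    if "i < d ^ 2" "j < d ^ 2" for i j
  proof -
    have digits: "j div d < d" "j mod d < d"
      using that(2)
      by (auto simp: power2_eq_square less_mult_imp_div_less intro!: mod_less_divisor gr0I)
    have "((inverse s * K $$ (i0, j0)) \<cdot>\<^sub>m reshape_row d K i) $$ (j div d, j mod d) =
        ((inverse s * K $$ (i, j0)) \<cdot>\<^sub>m reshape_row d K i0) $$ (j div d, j mod d)"
      unfolding rows[OF that(1)] ..
    then have "K $$ (i0, j0) * K $$ (i, j) = K $$ (i, j0) * K $$ (i0, j)"
      using digits \<open>s \<noteq> 0\<close> by (simp add: reshape_row_def)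
    then show ?thesis
      using nonzero by (simp add: field_simps)
  qed
  then show ?thesis
    by (rule vec_space.rank_eq_1_product_entries[OF K(1) _ K(2)])
qed

subsection \<open>Operators on three tensor factors\<close>

abbreviation on_12 :: "nat \<Rightarrow> complex mat \<Rightarrow> complex mat" where
  "on_12 d \<equiv> on_factors d 3 1 2"

abbreviation on_23 :: "nat \<Rightarrow> complex mat \<Rightarrow> complex mat" where
  "on_23 d \<equiv> on_factors d 3 2 3"

(* Keeps the factor numbers of on_12 from being rewritten to Suc 0. *)
declare One_nat_def [simp del]

lemma on_factors_carrier [simp]: "on_factors d n k l X \<in> carrier_mat (d ^ n) (d ^ n)"
  by (simp add: on_factors_def)

lemma digits3_less:
  assumes "i < d ^ 2" "c < (d::nat)"
  shows "i * d + c < d ^ 3" "c * d ^ 2 + i < d ^ 3"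
  using digits_less[of i "d ^ 2" c d] digits_less[of c d i "d ^ 2"] assms
  by (simp_all add: power3_eq_cube power2_eq_square mult.assoc)

lemma tensor_digit_append:
  assumes "i < d ^ 2" "c < d"
  shows "tensor_digit d 3 1 (i * d + c) = i div d" "tensor_digit d 3 2 (i * d + c) = i mod d"
    "tensor_digit d 3 3 (i * d + c) = c"
  using assms
  by (simp_all add: tensor_digit_def power2_eq_square div_mult2_eq less_mult_imp_div_less)

lemma tensor_digit_prepend:
  assumes "a < d" "i < d ^ 2"
  shows "tensor_digit d 3 1 (a * d ^ 2 + i) = a" "tensor_digit d 3 2 (a * d ^ 2 + i) = i div d"
    "tensor_digit d 3 3 (a * d ^ 2 + i) = i mod d"
proof -
  show "tensor_digit d 3 1 (a * d ^ 2 + i) = a"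
    using assms by (simp add: tensor_digit_def)
  have split: "a * d ^ 2 + i = (a * d) * d + i"
    by (simp add: power2_eq_square)
  have "i div d < d"
    using assms by (simp add: power2_eq_square less_mult_imp_div_less)
  then show "tensor_digit d 3 2 (a * d ^ 2 + i) = i div d"
    "tensor_digit d 3 3 (a * d ^ 2 + i) = i mod d"
    unfolding split using assms by (simp_all add: tensor_digit_def)
qed

lemma on_12_index:
  assumes "i < d ^ 2" "c < d" "j < d ^ 2" "c' < d"
  shows "on_12 d X $$ (i * d + c, j * d + c') = (if c = c' then X $$ (i, j) else 0)"
proof -
  have "{1..3} - {1, 2} = {3::nat}" by auto
  then show ?thesis
    using assms by (simp add: on_factors_def tensor_digit_append digits3_less)
qed

lemma on_23_index:
  assumes "a < d" "i < d ^ 2" "a' < d" "j < d ^ 2"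
  shows "on_23 d X $$ (a * d ^ 2 + i, a' * d ^ 2 + j) = (if a = a' then X $$ (i, j) else 0)"
proof -
  have "{1..3} - {2, 3} = {1::nat}" by auto
  then show ?thesis
    using assms by (simp add: on_factors_def tensor_digit_prepend digits3_less)
qed

lemma on_12_mult_index:
  assumes "i < d ^ 2" "c < d" "y < d ^ 3" and M: "M \<in> carrier_mat (d ^ 3) (d ^ 3)"
  shows "(on_12 d X * M) $$ (i * d + c, y) =
    (\<Sum>g<d. \<Sum>h<d. X $$ (i, g * d + h) * M $$ ((g * d + h) * d + c, y))"
proof -
  have "(on_12 d X * M) $$ (i * d + c, y) =
      (\<Sum>x<d ^ 2 * d. on_12 d X $$ (i * d + c, x) * M $$ (x, y))"
    using assms digits3_less
    by (simp add: index_mult_mat_sum[OF on_factors_carrier M] power3_eq_cube power2_eq_square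
        del: index_mult_mat(1))
  also have "\<dots> = (\<Sum>l<d ^ 2. \<Sum>b<d. (if c = b then X $$ (i, l) else 0) * M $$ (l * d + b, y))"
    unfolding sum_mult_digits by (intro sum.cong refl) (simp add: assms on_12_index)
  also have "\<dots> = (\<Sum>l<d ^ 2. X $$ (i, l) * M $$ (l * d + c, y))"
    using assms by (simp add: if_distrib[of "\<lambda>x. x * _"] cong: if_cong)
  finally show ?thesis
    by (simp add: sum_digits2)
qed

lemma on_23_mult_index:
  assumes "a < d" "i < d ^ 2" "y < d ^ 3" and M: "M \<in> carrier_mat (d ^ 3) (d ^ 3)"
  shows "(on_23 d X * M) $$ (a * d ^ 2 + i, y) =
    (\<Sum>g<d. \<Sum>h<d. X $$ (i, g * d + h) * M $$ (a * d ^ 2 + (g * d + h), y))"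
proof -
  have "(on_23 d X * M) $$ (a * d ^ 2 + i, y) =
      (\<Sum>x<d * d ^ 2. on_23 d X $$ (a * d ^ 2 + i, x) * M $$ (x, y))"
    using assms digits3_less
    by (simp add: index_mult_mat_sum[OF on_factors_carrier M] power3_eq_cube power2_eq_square
        mult.assoc del: index_mult_mat(1))
  also have "\<dots> = (\<Sum>b<d. \<Sum>l<d ^ 2. (if a = b then X $$ (i, l) else 0) * M $$ (b * d ^ 2 + l, y))"
    unfolding sum_mult_digits by (intro sum.cong refl) (simp add: assms on_23_index)
  also have "\<dots> = (\<Sum>l<d ^ 2. X $$ (i, l) * M $$ (a * d ^ 2 + l, y))"
    using assms by (subst sum.swap) (simp add: if_distrib[of "\<lambda>x. x * _"] cong: if_cong)
  finally show ?thesis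
    by (simp add: sum_digits2)
qed

lemma digits3_assoc: "a * d ^ 2 + (g * d + h) = (a * d + g) * d + (h::nat)"
  by (simp add: power2_eq_square algebra_simps)

lemma on_12_mult_on_23_index:
  assumes "i < d ^ 2" "c < d" "a < d" "j < d ^ 2"
  shows "(on_12 d X * on_23 d Y) $$ (i * d + c, a * d ^ 2 + j) =
    (\<Sum>b<d. X $$ (i, a * d + b) * Y $$ (b * d + c, j))"
proof -
  have "(on_12 d X * on_23 d Y) $$ (i * d + c, a * d ^ 2 + j) =
      (\<Sum>g<d. \<Sum>b<d. X $$ (i, g * d + b) * on_23 d Y $$ (g * d ^ 2 + (b * d + c), a * d ^ 2 + j))"
    unfolding digits3_assoc using assms
    by (intro on_12_mult_index) (auto simp: digits3_less)
  also have "\<dots> = (\<Sum>g<d. \<Sum>b<d. X $$ (i, g * d + b) * (if g = a then Y $$ (b * d + c, j) else 0))"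
    using assms by (simp add: on_23_index digits2_less)
  also have "\<dots> = (\<Sum>b<d. X $$ (i, a * d + b) * Y $$ (b * d + c, j))"
    using assms by (subst sum.swap) (simp add: if_distrib[of "\<lambda>x. _ * x"] cong: if_cong)
  finally show ?thesis .
qed

lemma on_23_mult_on_12_index:
  assumes "a < d" "i < d ^ 2" "j < d ^ 2" "c < d"
  shows "(on_23 d X * on_12 d Y) $$ (a * d ^ 2 + i, j * d + c) =
    (\<Sum>b<d. X $$ (i, b * d + c) * Y $$ (a * d + b, j))"
proof -
  have "(on_23 d X * on_12 d Y) $$ (a * d ^ 2 + i, j * d + c) =
      (\<Sum>b<d. \<Sum>h<d. X $$ (i, b * d + h) * on_12 d Y $$ ((a * d + b) * d + h, j * d + c))"
    unfolding digits3_assoc[symmetric] using assms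
    by (intro on_23_mult_index) (auto simp: digits3_less)
  also have "\<dots> = (\<Sum>b<d. \<Sum>h<d. X $$ (i, b * d + h) * (if h = c then Y $$ (a * d + b, j) else 0))"
    using assms by (simp add: on_12_index digits2_less)
  also have "\<dots> = (\<Sum>b<d. X $$ (i, b * d + c) * Y $$ (a * d + b, j))"
    using assms by (simp add: if_distrib[of "\<lambda>x. _ * x"] cong: if_cong)
  finally show ?thesis .
qed

lemma on_23_12_23_index:
  assumes "a < d" "i < d ^ 2" "a' < d" "j < d ^ 2"
  shows "(on_23 d X * on_12 d Y * on_23 d Z) $$ (a * d ^ 2 + i, a' * d ^ 2 + j) =
    trace_snd d Y (reshape_col d Z j * transpose_mat (reshape_row d X i)) $$ (a, a')"
proof -
  have "(on_23 d X * on_12 d Y * on_23 d Z) $$ (a * d ^ 2 + i, a' * d ^ 2 + j) =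
      (\<Sum>g<d. \<Sum>h<d. X $$ (i, g * d + h) *
        (\<Sum>b<d. Y $$ (a * d + g, a' * d + b) * Z $$ (b * d + h, j)))"
    using assms
    by (simp add: assoc_mult_mat[OF on_factors_carrier on_factors_carrier on_factors_carrier]
        on_23_mult_index mult_carrier_mat[OF on_factors_carrier on_factors_carrier]
        digits3_less digits2_less digits3_assoc on_12_mult_on_23_index)
  also have "\<dots> = (\<Sum>g<d. \<Sum>b<d. Y $$ (a * d + g, a' * d + b) *
      (\<Sum>h<d. X $$ (i, g * d + h) * Z $$ (b * d + h, j)))"
    unfolding sum_distrib_left by (subst (2) sum.swap) (simp add: mult_ac)
  also have "\<dots> = trace_snd d Y (reshape_col d Z j * transpose_mat (reshape_row d X i)) $$ (a, a')"
    using assms by (simp add: trace_snd_def reshape_col_mult_row_index del: index_mult_mat(1))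
  finally show ?thesis .
qed

lemma on_12_23_12_index:
  assumes "i < d ^ 2" "c < d" "j < d ^ 2" "c' < d"
  shows "(on_12 d X * on_23 d Y * on_12 d Z) $$ (i * d + c, j * d + c') =
    trace_fst d Y (transpose_mat (reshape_col d Z j) * reshape_row d X i) $$ (c, c')"
proof -
  have "(on_12 d X * on_23 d Y * on_12 d Z) $$ (i * d + c, j * d + c') =
      (\<Sum>g<d. \<Sum>h<d. X $$ (i, g * d + h) *
        (\<Sum>b<d. Y $$ (h * d + c, b * d + c') * Z $$ (g * d + b, j)))"
    using assms
    by (simp add: assoc_mult_mat[OF on_factors_carrier on_factors_carrier on_factors_carrier]
        on_12_mult_index mult_carrier_mat[OF on_factors_carrier on_factors_carrier]
        digits3_less digits2_less on_23_mult_on_12_index flip: digits3_assoc)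
  also have "\<dots> = (\<Sum>h<d. \<Sum>g<d. \<Sum>b<d.
      Y $$ (h * d + c, b * d + c') * (X $$ (i, g * d + h) * Z $$ (g * d + b, j)))"
    by (subst sum.swap) (simp add: sum_distrib_left mult_ac)
  also have "\<dots> = (\<Sum>h<d. \<Sum>b<d. Y $$ (h * d + c, b * d + c') *
      (\<Sum>g<d. X $$ (i, g * d + h) * Z $$ (g * d + b, j)))"
    unfolding sum_distrib_left by (subst (2) sum.swap) (rule refl)
  also have "\<dots> = trace_fst d Y (transpose_mat (reshape_col d Z j) * reshape_row d X i) $$ (c, c')"
    using assms
    by (simp add: trace_fst_def reshape_col_transpose_mult_row_index del: index_mult_mat(1))
  finally show ?thesis .
qed

lemma trace_snd_eq_if_23_12_23:
  assumes ij: "i < d ^ 2" "j < d ^ 2"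
    and rel: "on_23 d X * on_12 d Y * on_23 d X = s \<cdot>\<^sub>m on_23 d X"
  shows "trace_snd d Y (reshape_col d X j * transpose_mat (reshape_row d X i)) =
    (s * X $$ (i, j)) \<cdot>\<^sub>m 1\<^sub>m d"
    (is "?trace = _")
proof (rule eq_matI)
  fix a a'
  assume "a < dim_row ((s * X $$ (i, j)) \<cdot>\<^sub>m 1\<^sub>m d)" "a' < dim_col ((s * X $$ (i, j)) \<cdot>\<^sub>m 1\<^sub>m d)"
  then have bounds: "a < d" "a' < d" by auto
  have "?trace $$ (a, a') = (s \<cdot>\<^sub>m on_23 d X) $$ (a * d ^ 2 + i, a' * d ^ 2 + j)"
    using on_23_12_23_index[of a d i a' j X Y X] bounds ij unfolding rel by simp
  also have "\<dots> = ((s * X $$ (i, j)) \<cdot>\<^sub>m 1\<^sub>m d) $$ (a, a')"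
    using bounds ij carrier_matD[OF on_factors_carrier[of d 3 2 3 X]]
    by (simp add: digits3_less on_23_index)
  finally show "?trace $$ (a, a') = ((s * X $$ (i, j)) \<cdot>\<^sub>m 1\<^sub>m d) $$ (a, a')" .
qed (simp_all add: carrier_matD[OF trace_snd_carrier])

lemma trace_fst_eq_if_12_23_12:
  assumes ij: "i < d ^ 2" "j < d ^ 2"
    and rel: "on_12 d X * on_23 d Y * on_12 d X = s \<cdot>\<^sub>m on_12 d X"
  shows "trace_fst d Y (transpose_mat (reshape_col d X j) * reshape_row d X i) =
    (s * X $$ (i, j)) \<cdot>\<^sub>m 1\<^sub>m d"
    (is "?trace = _")
proof (rule eq_matI)
  fix c c'
  assume "c < dim_row ((s * X $$ (i, j)) \<cdot>\<^sub>m 1\<^sub>m d)" "c' < dim_col ((s * X $$ (i, j)) \<cdot>\<^sub>m 1\<^sub>m d)"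
  then have bounds: "c < d" "c' < d" by auto
  have "?trace $$ (c, c') = (s \<cdot>\<^sub>m on_12 d X) $$ (i * d + c, j * d + c')"
    using on_12_23_12_index[of i d c j c' X Y X] bounds ij unfolding rel by simp
  also have "\<dots> = ((s * X $$ (i, j)) \<cdot>\<^sub>m 1\<^sub>m d) $$ (c, c')"
    using bounds ij carrier_matD[OF on_factors_carrier[of d 3 1 2 X]]
    by (simp add: digits3_less on_12_index)
  finally show "?trace $$ (c, c') = ((s * X $$ (i, j)) \<cdot>\<^sub>m 1\<^sub>m d) $$ (c, c')" .
qed (simp_all add: carrier_matD[OF trace_fst_carrier])

subsection \<open>Skew invertibility\<close>

lemma partial_trace_on_12_on_23_index:
  assumes "a < d" "c < d" "a' < d" "c' < d"
  shows "partial_trace d 3 2 (on_12 d X * on_23 d Y) $$ (a * d + c, a' * d + c') =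
    (\<Sum>b<d. \<Sum>g<d. X $$ (a * d + b, a' * d + g) * Y $$ (g * d + c, b * d + c'))"
proof -
  have "insert_digit d 3 2 b (a * d + c) = (a * d + b) * d + c"
    "insert_digit d 3 2 b (a' * d + c') = a' * d ^ 2 + (b * d + c')" for b
    using assms by (simp_all add: insert_digit_def digits3_assoc)
  then show ?thesis
    using assms
    by (simp add: partial_trace_def digits2_less on_12_mult_on_23_index del: index_mult_mat(1))
qed

lemma flip_mat_index:
  assumes "a < d" "b < d" "a' < d" "b' < d"
  shows "flip_mat d $$ (a * d + b, a' * d + b') = (if a = b' \<and> b = a' then 1 else 0)"
  using assms by (simp add: flip_mat_def digits2_less tensor_digit_def)

lemma trace_snd_skew_inverse:
  assumes skew: "partial_trace d 3 2 (on_12 d \<Psi> * on_23 d R) = flip_mat d"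
    and T: "T \<in> carrier_mat d d"
  shows "trace_snd d \<Psi> (trace_snd d R T) = T"
proof (rule eq_matI)
  fix a b
  assume "a < dim_row T" "b < dim_col T"
  then have bounds: "a < d" "b < d" using T by auto
  have "trace_snd d \<Psi> (trace_snd d R T) $$ (a, b) =
      (\<Sum>v<d. \<Sum>u<d. \<Sum>g<d. \<Sum>h<d.
        \<Psi> $$ (a * d + v, b * d + u) * R $$ (u * d + g, v * d + h) * T $$ (h, g))"
    using bounds by (simp add: trace_snd_def sum_distrib_left mult.assoc)
  also have "\<dots> = (\<Sum>g<d. \<Sum>h<d. \<Sum>v<d. \<Sum>u<d.
        \<Psi> $$ (a * d + v, b * d + u) * R $$ (u * d + g, v * d + h) * T $$ (h, g))"
    by (rule sum_swap_pairs)
  also have "\<dots> = (\<Sum>g<d. \<Sum>h<d. flip_mat d $$ (a * d + g, b * d + h) * T $$ (h, g))"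
    using bounds by (simp add: partial_trace_on_12_on_23_index sum_distrib_right flip: skew)
  also have "\<dots> = (\<Sum>g<d. if g = b then T $$ (a, g) else 0)"
    using bounds
    by (intro sum.cong refl) (auto simp: flip_mat_index if_distrib[of "\<lambda>x. x * _"] cong: if_cong)
  also have "\<dots> = T $$ (a, b)"
    using bounds by simp
  finally show "trace_snd d \<Psi> (trace_snd d R T) $$ (a, b) = T $$ (a, b)" .
qed (use T in \<open>auto simp: trace_snd_def\<close>)

lemma contraction_if_skew_invertible:
  assumes "skew_invertible d R"
    and rel: "on_23 d K * on_12 d R * on_23 d K = s \<cdot>\<^sub>m on_23 d K"
  obtains D where "D \<in> carrier_mat d d"
    "\<And>i j. i < d ^ 2 \<Longrightarrow> j < d ^ 2 \<Longrightarrow>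
      reshape_col d K j * transpose_mat (reshape_row d K i) = (s * K $$ (i, j)) \<cdot>\<^sub>m D"
proof -
  obtain \<Psi> where skew: "partial_trace d 3 2 (on_12 d \<Psi> * on_23 d R) = flip_mat d"
    using assms(1) by (auto simp: skew_invertible_def)
  have "reshape_col d K j * transpose_mat (reshape_row d K i) =
      (s * K $$ (i, j)) \<cdot>\<^sub>m trace_snd d \<Psi> (1\<^sub>m d)"
    (is "?T = _") if "i < d ^ 2" "j < d ^ 2" for i j
  proof -
    have "?T = trace_snd d \<Psi> (trace_snd d R ?T)"
      by (rule trace_snd_skew_inverse[OF skew, symmetric]) (simp add: mult_carrier_mat[of _ d d])
    also have "\<dots> = trace_snd d \<Psi> ((s * K $$ (i, j)) \<cdot>\<^sub>m 1\<^sub>m d)"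
      unfolding trace_snd_eq_if_23_12_23[OF that rel] ..
    finally show ?thesis
      by (simp add: trace_snd_smult)
  qed
  then show thesis
    by (rule that[OF trace_snd_carrier])
qed

lemma rank_eq_1_if_skew_invertible:
  assumes skew: "skew_invertible d R"
    and K: "K \<in> carrier_mat (d ^ 2) (d ^ 2)" "K \<noteq> 0\<^sub>m (d ^ 2) (d ^ 2)"
    and K2R1K2: "on_23 d K * on_12 d R * on_23 d K = s \<cdot>\<^sub>m on_23 d K"
    and "s \<noteq> 0"
    and K2K1K2: "on_23 d K * on_12 d K * on_23 d K = on_23 d K"
    and K1K2K1: "on_12 d K * on_23 d K * on_12 d K = on_12 d K"
  shows "vec_space.rank (d ^ 2) K = 1"
proof -
  obtain D where D: "D \<in> carrier_mat d d" and contraction: "\<And>i j. i < d ^ 2 \<Longrightarrow> j < d ^ 2 \<Longrightarrow>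
      reshape_col d K j * transpose_mat (reshape_row d K i) = (s * K $$ (i, j)) \<cdot>\<^sub>m D"
    using contraction_if_skew_invertible[OF skew K2R1K2] by blast
  show ?thesis
  proof (rule rank_eq_1_contraction[OF K D \<open>s \<noteq> 0\<close> contraction])
    fix i j
    assume ij: "i < d ^ 2" "j < d ^ 2"
    show "trace_snd d K (reshape_col d K j * transpose_mat (reshape_row d K i)) =
        K $$ (i, j) \<cdot>\<^sub>m 1\<^sub>m d"
      using trace_snd_eq_if_23_12_23[OF ij, of K K 1] K2K1K2 by (simp add: one_smult_mat)
    show "trace_fst d K (transpose_mat (reshape_col d K j) * reshape_row d K i) =
        K $$ (i, j) \<cdot>\<^sub>m 1\<^sub>m d"
      using trace_fst_eq_if_12_23_12[OF ij, of K K 1] K1K2K1 by (simp add: one_smult_mat)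
  qed
qed

subsection \<open>Relations of the Birman-Murakami-Wenzl algebra\<close>

context
  fixes q \<nu> :: complex and n N :: nat and e e' \<kappa> :: "nat \<Rightarrow> complex mat"
  assumes representation: "BMW_representation q \<nu> n N e e' \<kappa>"
    and nonzero: "q - inverse q \<noteq> 0" "\<nu> \<noteq> 0"
begin

lemma BMW_carrier:
  assumes "i \<in> {1..<n}"
  shows "e i \<in> carrier_mat N N" "e' i \<in> carrier_mat N N" "\<kappa> i \<in> carrier_mat N N"
  using representation assms unfolding BMW_representation_def by blast+

lemma BMW_inverse:
  assumes "i \<in> {1..<n}"
  shows "e i * e' i = 1\<^sub>m N" "e' i * e i = 1\<^sub>m N"
  using representation assms unfolding BMW_representation_def by blast+

lemma BMW_generator_mult_kappa:
  assumes "i \<in> {1..<n}"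
  shows "e i * \<kappa> i = \<nu> \<cdot>\<^sub>m \<kappa> i"
  using representation assms unfolding BMW_representation_def by blast

lemma BMW_inverse_mult_cancel:
  assumes "i \<in> {1..<n}" "X \<in> carrier_mat N N"
  shows "e' i * (e i * X) = X"
  using BMW_carrier[OF assms(1)] BMW_inverse(2)[OF assms(1)] assms(2) by (simp flip: assoc_mult_mat)

lemma BMW_inverse_mult_kappa:
  assumes i: "i \<in> {1..<n}"
  shows "e' i * \<kappa> i = inverse \<nu> \<cdot>\<^sub>m \<kappa> i"
proof -
  note carrier = BMW_carrier[OF i]
  have "\<kappa> i = e' i * (e i * \<kappa> i)"
    by (rule BMW_inverse_mult_cancel[OF i carrier(3), symmetric])
  also have "e i * \<kappa> i = \<nu> \<cdot>\<^sub>m \<kappa> i"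
    by (rule BMW_generator_mult_kappa[OF i])
  also have "e' i * (\<nu> \<cdot>\<^sub>m \<kappa> i) = \<nu> \<cdot>\<^sub>m (e' i * \<kappa> i)"
    using carrier by (simp add: mult_smult_distrib)
  finally have "inverse \<nu> \<cdot>\<^sub>m \<kappa> i = inverse \<nu> \<cdot>\<^sub>m (\<nu> \<cdot>\<^sub>m (e' i * \<kappa> i))" by simp
  also have "\<dots> = e' i * \<kappa> i"
    using nonzero by (simp add: smult_smult_mat one_smult_mat)
  finally show ?thesis ..
qed

lemma BMW_skein:
  assumes i: "i \<in> {1..<n}"
  shows "(q - inverse q) \<cdot>\<^sub>m \<kappa> i = (q - inverse q) \<cdot>\<^sub>m 1\<^sub>m N + e' i - e i"
proof -
  note carrier = BMW_carrier[OF i]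
  have "e i = e' i * (e i * e i)"
    by (rule BMW_inverse_mult_cancel[OF i carrier(1), symmetric])
  moreover have "e i * e i = 1\<^sub>m N + (q - inverse q) \<cdot>\<^sub>m (e i - \<nu> \<cdot>\<^sub>m \<kappa> i)"
    using representation i unfolding BMW_representation_def by blast
  ultimately have "e i = e' i + (q - inverse q) \<cdot>\<^sub>m (1\<^sub>m N - \<nu> \<cdot>\<^sub>m (inverse \<nu> \<cdot>\<^sub>m \<kappa> i))"
    using carrier
    by (simp add: square_mat_simps[where N = N] BMW_inverse(2)[OF i] BMW_inverse_mult_kappa[OF i])
  also have "\<nu> \<cdot>\<^sub>m (inverse \<nu> \<cdot>\<^sub>m \<kappa> i) = \<kappa> i"
    using nonzero by (simp add: smult_smult_mat one_smult_mat)
  finally have "e i $$ (x, y) = (e' i + (q - inverse q) \<cdot>\<^sub>m (1\<^sub>m N - \<kappa> i)) $$ (x, y)" for x y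
    by simp
  then show ?thesis
    using carrier by (intro eq_matI) (auto simp: algebra_simps)
qed

lemma BMW_kappa_square:
  assumes i: "i \<in> {1..<n}"
  shows "(q - inverse q) \<cdot>\<^sub>m (\<kappa> i * \<kappa> i) = (q - inverse q) \<cdot>\<^sub>m \<kappa> i + inverse \<nu> \<cdot>\<^sub>m \<kappa> i - \<nu> \<cdot>\<^sub>m \<kappa> i"
proof -
  note carrier = BMW_carrier[OF i]
  have "(q - inverse q) \<cdot>\<^sub>m (\<kappa> i * \<kappa> i) = ((q - inverse q) \<cdot>\<^sub>m \<kappa> i) * \<kappa> i"
    using carrier by (simp add: mult_smult_assoc_mat)
  also have "\<dots> = ((q - inverse q) \<cdot>\<^sub>m 1\<^sub>m N + e' i - e i) * \<kappa> i"
    unfolding BMW_skein[OF i] ..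
  also have "\<dots> = (q - inverse q) \<cdot>\<^sub>m \<kappa> i + inverse \<nu> \<cdot>\<^sub>m \<kappa> i - \<nu> \<cdot>\<^sub>m \<kappa> i"
    using carrier
    by (simp add: square_mat_simps[where N = N] BMW_generator_mult_kappa[OF i]
        BMW_inverse_mult_kappa[OF i])
  finally show ?thesis .
qed

lemma BMW_kappa_212:
  assumes i: "i \<in> {1..<n}" and i_next: "i + 1 \<in> {1..<n}"
  shows "\<kappa> (i + 1) * \<kappa> i * \<kappa> (i + 1) = \<kappa> (i + 1)"
proof -
  let ?k = "\<kappa> (i + 1)"
  note carrier = BMW_carrier[OF i] BMW_carrier[OF i_next]
  have sandwich: "?k * e i * ?k = inverse \<nu> \<cdot>\<^sub>m ?k" "?k * e' i * ?k = \<nu> \<cdot>\<^sub>m ?k"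
    using representation i i_next unfolding BMW_representation_def by blast+
  have "(q - inverse q) \<cdot>\<^sub>m (?k * \<kappa> i * ?k) = ?k * ((q - inverse q) \<cdot>\<^sub>m \<kappa> i) * ?k"
    using carrier by (simp add: square_mat_simps[where N = N])
  also have "\<dots> = (q - inverse q) \<cdot>\<^sub>m (?k * ?k) + ?k * e' i * ?k - ?k * e i * ?k"
    unfolding BMW_skein[OF i] using carrier by (simp add: square_mat_simps[where N = N])
  also have "\<dots> = (q - inverse q) \<cdot>\<^sub>m ?k"
    unfolding sandwich BMW_kappa_square[OF i_next] using carrier by (intro eq_matI) auto
  finally show ?thesis
    using nonzero(1) by (simp add: smult_mat_cancel_left)
qed

lemma BMW_kappa_intertwine:
  assumes i: "i \<in> {1..<n}" and j: "j \<in> {1..<n}"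
    and g: "g \<in> carrier_mat N N" and intertwines: "g * e i = e j * g"
  shows "g * \<kappa> i = \<kappa> j * g"
proof -
  note carrier = BMW_carrier[OF i] BMW_carrier[OF j] g
  have "e' j * g = e' j * ((g * e i) * e' i)"
    using carrier by (simp add: square_mat_simps[where N = N] BMW_inverse(1)[OF i])
  also have "\<dots> = e' j * (e j * (g * e' i))"
    unfolding intertwines using carrier by (simp add: square_mat_simps[where N = N])
  also have "\<dots> = g * e' i"
    using carrier by (intro BMW_inverse_mult_cancel[OF j]) simp
  finally have intertwines_inverse: "g * e' i = e' j * g" ..
  have "(q - inverse q) \<cdot>\<^sub>m (g * \<kappa> i) = g * ((q - inverse q) \<cdot>\<^sub>m \<kappa> i)"
    using carrier by (simp add: square_mat_simps[where N = N])
  also have "\<dots> = (q - inverse q) \<cdot>\<^sub>m g + g * e' i - g * e i"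
    unfolding BMW_skein[OF i] using carrier by (simp add: square_mat_simps[where N = N])
  also have "\<dots> = ((q - inverse q) \<cdot>\<^sub>m 1\<^sub>m N + e' j - e j) * g"
    unfolding intertwines intertwines_inverse using carrier
    by (simp add: square_mat_simps[where N = N])
  also have "\<dots> = (q - inverse q) \<cdot>\<^sub>m (\<kappa> j * g)"
    unfolding BMW_skein[OF j, symmetric] using carrier by (simp add: square_mat_simps[where N = N])
  finally show ?thesis
    using nonzero(1) by (simp add: smult_mat_cancel_left)
qed

(* Conjugation by the half twist e i * e (i + 1) * e i exchanges the two generators. *)
lemma BMW_kappa_121:
  assumes i: "i \<in> {1..<n}" and i_next: "i + 1 \<in> {1..<n}"
  shows "\<kappa> i * \<kappa> (i + 1) * \<kappa> i = \<kappa> i"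
proof -
  define twist where "twist = e i * e (i + 1) * e i"
  note carrier = BMW_carrier[OF i] BMW_carrier[OF i_next]
  have twist: "twist \<in> carrier_mat N N"
    using carrier by (simp add: twist_def)
  have braid: "twist = e (i + 1) * e i * e (i + 1)"
    using representation i i_next unfolding BMW_representation_def twist_def by blast
  have "twist * e i = e (i + 1) * (e i * e (i + 1) * e i)"
    unfolding braid using carrier by (simp add: square_mat_simps[where N = N])
  then have twist_kappa: "twist * \<kappa> i = \<kappa> (i + 1) * twist"
    by (intro BMW_kappa_intertwine[OF i i_next twist]) (simp add: twist_def)
  have "twist * e (i + 1) = e i * (e (i + 1) * e i * e (i + 1))"
    unfolding twist_def using carrier by (simp add: square_mat_simps[where N = N])
  then have twist_kappa_Suc: "twist * \<kappa> (i + 1) = \<kappa> i * twist"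
    by (intro BMW_kappa_intertwine[OF i_next i twist]) (simp add: braid)
  have twist_cancel: "e' i * (e' (i + 1) * (e' i * (twist * X))) = X" if "X \<in> carrier_mat N N" for X
    unfolding twist_def using carrier that i i_next
    by (simp add: square_mat_simps[where N = N] BMW_inverse_mult_cancel)
  have "twist * (\<kappa> i * \<kappa> (i + 1) * \<kappa> i) = (twist * \<kappa> i) * (\<kappa> (i + 1) * \<kappa> i)"
    using carrier twist by (simp add: square_mat_simps[where N = N])
  also have "\<dots> = \<kappa> (i + 1) * ((twist * \<kappa> (i + 1)) * \<kappa> i)"
    unfolding twist_kappa using carrier twist by (simp add: square_mat_simps[where N = N])
  also have "\<dots> = \<kappa> (i + 1) * \<kappa> i * (twist * \<kappa> i)"
    unfolding twist_kappa_Suc using carrier twist by (simp add: square_mat_simps[where N = N])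
  also have "\<dots> = (\<kappa> (i + 1) * \<kappa> i * \<kappa> (i + 1)) * twist"
    unfolding twist_kappa using carrier twist by (simp add: square_mat_simps[where N = N])
  also have "\<dots> = twist * \<kappa> i"
    unfolding BMW_kappa_212[OF i i_next] twist_kappa ..
  finally show ?thesis
    using twist_cancel[of "\<kappa> i * \<kappa> (i + 1) * \<kappa> i"] twist_cancel[of "\<kappa> i"] carrier by simp
qed

end

subsection \<open>The rank of the contraction operator\<close>

lemma K_mat_carrier: "R \<in> carrier_mat (d ^ 2) (d ^ 2) \<Longrightarrow> K_mat d q \<nu> R \<in> carrier_mat (d ^ 2) (d ^ 2)"
  by (auto simp: K_mat_def intro!: mult_carrier_mat)

lemma K_mat_eq:
  assumes R: "R \<in> carrier_mat (d ^ 2) (d ^ 2)" and "q \<noteq> 0"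
  shows "K_mat d q \<nu> R =
    (inverse (q - inverse q) * inverse \<nu>) \<cdot>\<^sub>m (1\<^sub>m (d ^ 2) + (q - inverse q) \<cdot>\<^sub>m R - R * R)"
proof -
  let ?I = "1\<^sub>m (d ^ 2) :: complex mat"
  have "(q \<cdot>\<^sub>m ?I - R) * (inverse q \<cdot>\<^sub>m ?I + R) = inverse q \<cdot>\<^sub>m (q \<cdot>\<^sub>m ?I - R) + (q \<cdot>\<^sub>m R - R * R)"
    using R by (simp add: square_mat_simps[where N = "d ^ 2"])
  also have "\<dots> = ?I + (q - inverse q) \<cdot>\<^sub>m R - R * R"
    using R \<open>q \<noteq> 0\<close> by (intro eq_matI) (auto simp: algebra_simps simp del: index_mult_mat(1))
  finally show ?thesis
    by (simp add: K_mat_def)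
qed

lemma poly_at_mat_quadratic:
  assumes "A \<in> carrier_mat N N" and "c \<noteq> 0"
  shows "poly_at_mat [:a, b, c:] A = a \<cdot>\<^sub>m 1\<^sub>m N + b \<cdot>\<^sub>m A + c \<cdot>\<^sub>m (A * A)"
  using assms
  by (intro eq_matI)
    (auto simp: poly_at_mat_def numeral_2_eq_2 One_nat_def simp del: index_mult_mat(1))

lemma K_mat_nonzero:
  assumes R: "R \<in> carrier_mat (d ^ 2) (d ^ 2)" and nonzero: "q \<noteq> 0" "q - inverse q \<noteq> 0" "\<nu> \<noteq> 0"
    and p: "is_minimal_poly p R" "degree p > 2"
  shows "K_mat d q \<nu> R \<noteq> 0\<^sub>m (d ^ 2) (d ^ 2)"
proof
  let ?r = "[:1, q - inverse q, -1:]" and ?c = "inverse (q - inverse q) * inverse \<nu>"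
  assume "K_mat d q \<nu> R = 0\<^sub>m (d ^ 2) (d ^ 2)"
  then have "?c \<cdot>\<^sub>m (1\<^sub>m (d ^ 2) + (q - inverse q) \<cdot>\<^sub>m R - R * R) = ?c \<cdot>\<^sub>m 0\<^sub>m (d ^ 2) (d ^ 2)"
    using K_mat_eq[OF R nonzero(1)] by simp
  then have "1\<^sub>m (d ^ 2) + (q - inverse q) \<cdot>\<^sub>m R - R * R = 0\<^sub>m (d ^ 2) (d ^ 2)"
    using nonzero by (subst (asm) smult_mat_cancel_left) auto
  moreover have "poly_at_mat ?r R = 1\<^sub>m (d ^ 2) + (q - inverse q) \<cdot>\<^sub>m R - R * R"
    unfolding poly_at_mat_quadratic[OF R, of "-1", simplified] using R by (intro eq_matI) auto
  ultimately have "annihilates ?r R"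
    using R by (simp add: annihilates_def)
  then have "p dvd ?r"
    using p(1) by (simp add: is_minimal_poly_def)
  then have "degree p \<le> degree ?r"
    by (rule dvd_imp_degree_le) simp
  then show False
    using p(2) by simp
qed

theorem mainTheorem1:
  fixes d :: nat and R :: "complex mat" and q \<nu> :: complex
  assumes "q \<notin> {0, 1, -1}"
    and "\<nu> \<notin> {0, q, - inverse q}"
    and "R_matrix d R"
    and "skew_invertible d R"
    and "BMW_type d q \<nu> R"
  shows "vec_space.rank (d ^ 2) (K_mat d q \<nu> R) = 1"
proof -
  let ?K = "K_mat d q \<nu> R"
  let ?K1 = "on_12 d ?K" and ?K2 = "on_23 d ?K"
  have nonzero: "q \<noteq> 0" "q - inverse q \<noteq> 0" "\<nu> \<noteq> 0"
    using assms(1,2) by (auto simp: field_simps square_eq_1_iff)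
  have R: "R \<in> carrier_mat (d ^ 2) (d ^ 2)"
    using assms(3) by (simp add: R_matrix_def)
  obtain e' where rep: "BMW_representation q \<nu> 3 (d ^ 3)
      (\<lambda>i. on_adjacent d 3 i R) e' (\<lambda>i. on_adjacent d 3 i ?K)"
    using assms(5) unfolding BMW_type_def by blast
  have "?K2 * ?K1 * ?K2 = ?K2" "?K1 * ?K2 * ?K1 = ?K1"
    using BMW_kappa_212[OF rep nonzero(2,3), of 1]
      BMW_kappa_121[OF rep nonzero(2,3), of 1] by simp_all
  moreover have "?K2 * on_12 d R * ?K2 = inverse \<nu> \<cdot>\<^sub>m ?K2"
    using rep unfolding BMW_representation_def by force
  moreover have "?K \<noteq> 0\<^sub>m (d ^ 2) (d ^ 2)"
    using assms(5) K_mat_nonzero[OF R nonzero] unfolding BMW_type_def by fastforce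
  ultimately show ?thesis
    using rank_eq_1_if_skew_invertible[OF assms(4) K_mat_carrier[OF R]] nonzero(3) by simp
qed

end
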